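(* Let $(\varepsilon,\lessdot)$ be a prioritized Extended Bundle Event Structure with $\varepsilon=(E,\leadsto,\mapsto,l)$, let $\langle C,\preceq_C,l|_C\rangle\in\mathrm{lposets}(\varepsilon)$, and let $\lessdot'=\lessdot\setminus\{(e,e')\in C\times C\mid e'\preceq_C e\}$. Then $\mathrm{Traces}(\varepsilon,\lessdot)|_C=\mathrm{Traces}(\varepsilon,\lessdot')|_C$.
   Context: An Extended Bundle Event Structure (EBES) is a quadruple $\varepsilon=(E,\leadsto,\mapsto,l)$ where $E$ is a set of events, $\leadsto\subseteq E\times E$ is an irreflexive relation (disabling; $e\leadsto e'$ means that once $e'$ has occurred, $e$ can no longer occur), $\mapsto\subseteq\mathcal{P}(E)\times E$ is the enabling relation (a pair $(X,e)$ is written $X\mapsto e$), and $l:E\to Act$ is a labeling function, satisfying Stability: whenever $X\mapsto e$, any two distinct $e_1,e_2\in X$ satisfy $e_1\leadsto e_2$. For a finite sequence $\sigma=e_1\cdots e_n$ write $\bar\sigma=\{e_1,\dots,e_n\}$, $\sigma_i=e_1\cdots e_i$ ($\sigma_0$ empty), and $\mathrm{en}_\varepsilon(\sigma)=\{e\in E\setminus\bar\sigma\mid(\forall X\subseteq E.\ X\mapsto e\Rightarrow X\cap\bar\sigma\neq\emptyset)\wedge\neg\exists e'\in\bar\sigma.\ e\leadsto e'\}$. $\sigma$ is a trace of $\varepsilon$ iff $e_i\in\mathrm{en}_\varepsilon(\sigma_{i-1})$ for all $1\le i\le n$. A set $C\subseteq E$ is a configuration of $\varepsilon$ iff $C=\bar\sigma$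 for some trace $\sigma$ of $\varepsilon$. For a configuration $C$, define $\prec_C\subseteq C\times C$ by $e\prec_C e'$ iff $(\exists X\subseteq E.\ X\mapsto e'\wedge e\in X)\vee e\leadsto e'$, and let $\preceq_C$ be the reflexive and transitive closure of $\prec_C$ on $C$. $\mathrm{lposets}(\varepsilon)$ is the set of triples $\langle C,\preceq_C,l|_C\rangle$ for all configurations $C$ of $\varepsilon$. A prioritized EBES (PEBES) is a pair $(\varepsilon,\lessdot)$ with $\lessdot\subseteq E\times E$ acyclic ($e\lessdot e'$: $e'$ has higher priority). $\sigma=e_1\cdots e_n$ is a trace of $(\varepsilon,\lessdot)$ iff $\sigma$ is a trace of $\varepsilon$ and for all $0\le i<n$ and all $e_j,e_h\in\bar\sigma$ with $e_j\neq e_h$, $e_j,e_h\in\mathrm{en}_\varepsilon(\sigma_i)$ and $e_h\lessdot e_j$, we have $j<h$; $\mathrm{Traces}(\varepsilon,\lessdot)$ is the set of these traces (same for subrelations of $\lessdot$), and $\mathrm{Traces}(\varepsilon,\lessdot)|_C=\{\sigma\in\mathrm{Traces}(\varepsilon,\lessdot)\mid\bar\sigma=C\}$. *)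

theory Defs
  imports Main "HOL-Library.FuncSet"
begin

(* (e, e') \<in> disabling: once e' has occurred, e can no longer occur.
   Only the values of labelling on events matter; Act is the type 'act. *)
record ('e, 'act) ebes =
  events :: "'e set"
  disabling :: "('e \<times> 'e) set"
  enabling :: "('e set \<times> 'e) set"
  labelling :: "'e \<Rightarrow> 'act"

definition is_ebes :: "('e, 'act) ebes \<Rightarrow> bool" where
  "is_ebes \<epsilon> \<longleftrightarrow>
     disabling \<epsilon> \<subseteq> events \<epsilon> \<times> events \<epsilon> \<and>
     irrefl (disabling \<epsilon>) \<and>
     enabling \<epsilon> \<subseteq> Pow (events \<epsilon>) \<times> events \<epsilon> \<and>
     (\<forall>(X, e) \<in> enabling \<epsilon>. \<forall>e1 \<in> X. \<forall>e2 \<in> X. e1 \<noteq> e2 \<longrightarrow> (e1, e2) \<in> disabling \<epsilon>)"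

definition enabled :: "('e, 'act) ebes \<Rightarrow> 'e list \<Rightarrow> 'e set" where
  "enabled \<epsilon> \<sigma> = {e \<in> events \<epsilon> - set \<sigma>.
     (\<forall>X \<subseteq> events \<epsilon>. (X, e) \<in> enabling \<epsilon> \<longrightarrow> X \<inter> set \<sigma> \<noteq> {}) \<and>
     \<not> (\<exists>e' \<in> set \<sigma>. (e, e') \<in> disabling \<epsilon>)}"

(* List positions start at 0, so the condition e_i \<in> en(\<sigma>_{i-1}) for 1 \<le> i \<le> n
   is stated with i shifted by one. *)
definition is_trace :: "('e, 'act) ebes \<Rightarrow> 'e list \<Rightarrow> bool" where
  "is_trace \<epsilon> \<sigma> \<longleftrightarrow> (\<forall>i < length \<sigma>. \<sigma> ! i \<in> enabled \<epsilon> (take i \<sigma>))"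

definition is_configuration :: "('e, 'act) ebes \<Rightarrow> 'e set \<Rightarrow> bool" where
  "is_configuration \<epsilon> C \<longleftrightarrow> C \<subseteq> events \<epsilon> \<and> (\<exists>\<sigma>. is_trace \<epsilon> \<sigma> \<and> C = set \<sigma>)"

definition precedes :: "('e, 'act) ebes \<Rightarrow> 'e set \<Rightarrow> ('e \<times> 'e) set" where
  "precedes \<epsilon> C = {(e, e') \<in> C \<times> C.
     (\<exists>X \<subseteq> events \<epsilon>. (X, e') \<in> enabling \<epsilon> \<and> e \<in> X) \<or> (e, e') \<in> disabling \<epsilon>}"

(* Reflexive and transitive closure on C, whereas rtrancl would be reflexive on the
   whole type. *)
definition precedes_eq :: "('e, 'act) ebes \<Rightarrow> 'e set \<Rightarrow> ('e \<times> 'e) set" where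
  "precedes_eq \<epsilon> C = Id_on C \<union> (precedes \<epsilon> C)\<^sup>+"

definition lposets :: "('e, 'act) ebes \<Rightarrow> ('e set \<times> ('e \<times> 'e) set \<times> ('e \<Rightarrow> 'act)) set" where
  "lposets \<epsilon> = {(C, precedes_eq \<epsilon> C, restrict (labelling \<epsilon>) C) | C. is_configuration \<epsilon> C}"

(* (e, e') \<in> prio: e' has higher priority than e. *)
definition is_pebes :: "('e, 'act) ebes \<Rightarrow> ('e \<times> 'e) set \<Rightarrow> bool" where
  "is_pebes \<epsilon> prio \<longleftrightarrow> is_ebes \<epsilon> \<and> prio \<subseteq> events \<epsilon> \<times> events \<epsilon> \<and> acyclic prio"

definition prio_traces :: "('e, 'act) ebes \<Rightarrow> ('e \<times> 'e) set \<Rightarrow> 'e list set" where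
  "prio_traces \<epsilon> prio = {\<sigma>. is_trace \<epsilon> \<sigma> \<and>
     (\<forall>i < length \<sigma>. \<forall>j < length \<sigma>. \<forall>h < length \<sigma>.
        \<sigma> ! j \<noteq> \<sigma> ! h \<and>
        \<sigma> ! j \<in> enabled \<epsilon> (take i \<sigma>) \<and> \<sigma> ! h \<in> enabled \<epsilon> (take i \<sigma>) \<and>
        (\<sigma> ! h, \<sigma> ! j) \<in> prio \<longrightarrow> j < h)}"

definition prio_traces_on ::
    "('e, 'act) ebes \<Rightarrow> ('e \<times> 'e) set \<Rightarrow> 'e set \<Rightarrow> 'e list set" where
  "prio_traces_on \<epsilon> prio C = {\<sigma> \<in> prio_traces \<epsilon> prio. set \<sigma> = C}"

end

theory Submission
  imports Defs
begin

text \<open>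
  Every trace over \<open>C\<close> lists its events in an order extending \<open>precedes_eq \<epsilon> C\<close>: if a bundle
  \<open>X\<close> enables \<open>e'\<close> and contains \<open>e\<close>, then the member of \<open>X\<close> that occurs before \<open>e'\<close> must be
  \<open>e\<close> itself, because by stability two members of a bundle disable each other and so cannot
  share a trace. Hence the condition imposed by a removed priority pair holds in every trace.
\<close>

lemma trace_nth_enabled:
  assumes "is_trace \<epsilon> \<sigma>" "i < length \<sigma>"
  shows "\<sigma> ! i \<in> enabled \<epsilon> (take i \<sigma>)"
  using assms by (simp add: is_trace_def)

lemma nth_mem_take:
  assumes "i < j" "j < length \<sigma>"
  shows "\<sigma> ! i \<in> set (take j \<sigma>)"
proof -
  have "take j \<sigma> ! i \<in> set (take j \<sigma>)"
    using assms by (intro nth_mem) simp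
  with assms show ?thesis by simp
qed

text \<open>If \<open>\<sigma> ! j\<close> came first, \<open>\<sigma> ! i\<close> would already be
  disabled at its own position. The bound is weak because a self-disabling event is not excluded
  here; irreflexivity makes it strict in \<open>precedes_trace_less\<close>.\<close>

lemma disabling_trace_le:
  assumes "is_trace \<epsilon> \<sigma>" "i < length \<sigma>" "j < length \<sigma>"
    and "(\<sigma> ! i, \<sigma> ! j) \<in> disabling \<epsilon>"
  shows "i \<le> j"
proof (rule ccontr)
  assume "\<not> i \<le> j"
  then have "\<sigma> ! j \<in> set (take i \<sigma>)"
    using nth_mem_take[of j i \<sigma>] assms(2) by simp
  then show False
    using trace_nth_enabled[OF assms(1,2)] assms(4) by (auto simp: enabled_def)
qed

lemma bundle_trace_less:
  assumes "is_ebes \<epsilon>" "is_trace \<epsilon> \<sigma>" "i < length \<sigma>" "j < length \<sigma>"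
    and "(X, \<sigma> ! j) \<in> enabling \<epsilon>" "\<sigma> ! i \<in> X"
  shows "i < j"
proof -
  have "X \<inter> set (take j \<sigma>) \<noteq> {}"
    using trace_nth_enabled[OF assms(2,4)] assms(1,5)
    by (auto simp: enabled_def is_ebes_def)
  then obtain k where k: "k < j" "\<sigma> ! k \<in> X"
    by (auto simp: in_set_conv_nth)
  show ?thesis
  proof (cases "\<sigma> ! i = \<sigma> ! k")
    case True
    \<comment> \<open>An enabled event has not occurred yet, so no event repeats in a trace; hence i
      \<le> k < j.\<close>
    then have "\<not> k < i"
      using trace_nth_enabled[OF assms(2,3)] nth_mem_take[of k i \<sigma>] assms(3)
      by (auto simp: enabled_def)
    with k show ?thesis by simp
  next
    case False
    \<comment> \<open>One direction of the mutual disabling given by stability already yields i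
      \<le> k < j, so this case is not refuted.\<close>
    then have "(\<sigma> ! i, \<sigma> ! k) \<in> disabling \<epsilon>"
      using assms(1,5,6) k unfolding is_ebes_def by blast
    then have "i \<le> k"
      using disabling_trace_le[OF assms(2,3)] k assms(4) by simp
    with k show ?thesis by simp
  qed
qed

lemma precedes_trace_less:
  assumes "is_ebes \<epsilon>" "is_trace \<epsilon> \<sigma>" "i < length \<sigma>" "j < length \<sigma>"
    and "(\<sigma> ! i, \<sigma> ! j) \<in> precedes \<epsilon> C"
  shows "i < j"
proof (cases "(\<sigma> ! i, \<sigma> ! j) \<in> disabling \<epsilon>")
  case True
  then have "i \<noteq> j"
    using assms(1) by (auto simp: is_ebes_def irrefl_def)
  then show ?thesis
    using disabling_trace_le[OF assms(2-4) True] by simp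
next
  case False
  then show ?thesis
    using assms(5) bundle_trace_less[OF assms(1-4)] by (auto simp: precedes_def)
qed

text \<open>Chains stay inside \<open>set \<sigma>\<close>, so every intermediate event has a
  position and the strict inequalities compose.\<close>

lemma trancl_precedes_trace_less:
  assumes "is_ebes \<epsilon>" "is_trace \<epsilon> \<sigma>" "i < length \<sigma>" "j < length \<sigma>"
    and "(\<sigma> ! i, \<sigma> ! j) \<in> (precedes \<epsilon> (set \<sigma>))\<^sup>+"
  shows "i < j"
proof -
  \<comment> \<open>The endpoint becomes a free event \<open>y\<close> for the induction on the
    closure; quantifying over all its positions lets the hypothesis apply to whichever
    \<open>k\<close> is picked.\<close>
  have "\<forall>j < length \<sigma>. \<sigma> ! j = y \<longrightarrow> i < j"
    if "(\<sigma> ! i, y) \<in> (precedes \<epsilon> (set \<sigma>))\<^sup>+" for y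
    using that
  proof induction
    case (base y)
    then show ?case
      using precedes_trace_less[OF assms(1-3)] by blast
  next
    case (step y z)
    from step.hyps(2) have "y \<in> set \<sigma>"
      by (auto simp: precedes_def)
    then obtain k where "k < length \<sigma>" "\<sigma> ! k = y"
      by (auto simp: in_set_conv_nth)
    moreover from this have "i < k"
      using step.IH by blast
    ultimately show ?case
      using step.hyps(2) precedes_trace_less[OF assms(1,2), of k] less_trans by blast
  qed
  then show ?thesis using assms(4,5) by blast
qed

lemma prio_traces_antimono: "prio' \<subseteq> prio \<Longrightarrow> prio_traces \<epsilon> prio \<subseteq> prio_traces \<epsilon> prio'"
  unfolding prio_traces_def by blast

theorem theorem7:
  fixes \<epsilon> :: "('e, 'act) ebes"
    and prio prio' :: "('e \<times> 'e) set"
    and C :: "'e set"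
  assumes "is_pebes \<epsilon> prio"
    and "(C, precedes_eq \<epsilon> C, restrict (labelling \<epsilon>) C) \<in> lposets \<epsilon>"
    and "prio' = prio - {(e, e') \<in> C \<times> C. (e', e) \<in> precedes_eq \<epsilon> C}"
  shows "prio_traces_on \<epsilon> prio C = prio_traces_on \<epsilon> prio' C"
proof
  show "prio_traces_on \<epsilon> prio C \<subseteq> prio_traces_on \<epsilon> prio' C"
    using prio_traces_antimono[of prio' prio \<epsilon>] assms(3)
    unfolding prio_traces_on_def by blast
next
  have ebes: "is_ebes \<epsilon>"
    using assms(1) by (simp add: is_pebes_def)
  show "prio_traces_on \<epsilon> prio' C \<subseteq> prio_traces_on \<epsilon> prio C"
  proof
    fix \<sigma> assume "\<sigma> \<in> prio_traces_on \<epsilon> prio' C"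
    then have \<sigma>: "\<sigma> \<in> prio_traces \<epsilon> prio'" and C: "set \<sigma> = C"
      by (simp_all add: prio_traces_on_def)
    then have trace: "is_trace \<epsilon> \<sigma>"
      by (simp add: prio_traces_def)
    have "j < h"
      if "i < length \<sigma>" "j < length \<sigma>" "h < length \<sigma>" "\<sigma> ! j \<noteq> \<sigma> ! h"
        "\<sigma> ! j \<in> enabled \<epsilon> (take i \<sigma>)" "\<sigma> ! h \<in> enabled \<epsilon> (take i \<sigma>)"
        "(\<sigma> ! h, \<sigma> ! j) \<in> prio" for i j h
    proof (cases "(\<sigma> ! h, \<sigma> ! j) \<in> prio'")
      case True
      with that \<sigma> show ?thesis
        unfolding prio_traces_def by blast
    next
      case False
      \<comment> \<open>The pair was removed, so its higher-priority event
        \<open>\<sigma> ! j\<close> lies below \<open>\<sigma> ! h\<close> in the causal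
        order.\<close>
      then have "(\<sigma> ! j, \<sigma> ! h) \<in> precedes_eq \<epsilon> C"
        using that(7) assms(3) by blast
      \<comment> \<open>Distinctness of the two events rules out the reflexive part
        \<open>Id_on C\<close>.\<close>
      then have "(\<sigma> ! j, \<sigma> ! h) \<in> (precedes \<epsilon> (set \<sigma>))\<^sup>+"
        using that(4) C by (auto simp only: precedes_eq_def Un_iff Id_on_iff)
      with that show ?thesis
        using trancl_precedes_trace_less[OF ebes trace] by blast
    qed
    then have "\<sigma> \<in> prio_traces \<epsilon> prio"
      using trace unfolding prio_traces_def by blast
    with C show "\<sigma> \<in> prio_traces_on \<epsilon> prio C"
      by (simp add: prio_traces_on_def)
  qed
qed

end
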